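(* For an arbitrary snark $G$, the following statements are equivalent: (i) $G$ is bicritical; (ii) $G$ is $4$-vertex-critical; (iii) $G$ is $7$-irreducible; (iv) $G$ is irreducible.
   Context: Graphs may have parallel edges and loops. A snark is a connected cubic graph that admits no proper edge-colouring with three colours (equivalently, no nowhere-zero $4$-flow). For distinct vertices $u,v$ of $G$, $G-\{u,v\}$ denotes the graph obtained by removing $u$ and $v$ but retaining the edges formerly incident with them as dangling edges, and $G/\{u,v\}$ denotes the graph obtained by identifying $u$ and $v$. A snark $G$ is bicritical if $G-\{u,v\}$ is $3$-edge-colourable for every pair of distinct vertices $u,v$. A snark $G$ is $4$-vertex-critical if $G/\{u,v\}$ admits a nowhere-zero $4$-flow for every pair of distinct vertices $u,v$. For an integer $k\ge1$, a snark $G$ is $k$-irreducible if removing fewer than $k$ edges from $G$ never produces a component of chromatic index $4$ that can be completed (by adding vertices and edges) to a cubic graph $H$ with fewer vertices than $G$; $G$ is irreducible if it is $k$-irreducible for every $k\ge1$.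
   Formalization: In k-irreducibility, "component of chromatic index 4" also includes components containing a loop (no proper edge-colouring, index infinite); read literally the claim fails for the claw with a loop at each leaf. For loopless snarks nothing changes. *)

theory Defs
  imports Main "HOL-Library.Multiset" "HOL-Library.Extended_Nat"
begin

text \<open>
  Undirected multigraphs, possibly with dangling edges (multipoles). Each edge carries the
  multiset of the vertices at its ends: \<open>{#x, y#}\<close> for an ordinary edge, \<open>{#x, x#}\<close> for a loop,
  \<open>{#x#}\<close> for an edge dangling at one end and \<open>{#}\<close> for an edge dangling at both ends.
\<close>

record ('v, 'e) multipole =
  verts :: "'v set"
  edges :: "'e set"
  ends :: "'e \<Rightarrow> 'v multiset"

definition graph :: "('v, 'e) multipole \<Rightarrow> bool" where
  "graph G \<longleftrightarrow> finite (verts G) \<and> finite (edges G) \<and>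
     (\<forall>e\<in>edges G. size (ends G e) = 2 \<and> set_mset (ends G e) \<subseteq> verts G)"

text \<open>A loop contributes 2 to the degree of its vertex.\<close>

definition degree :: "('v, 'e) multipole \<Rightarrow> 'v \<Rightarrow> nat" where
  "degree G v = (\<Sum>e\<in>edges G. count (ends G e) v)"

definition cubic_graph :: "('v, 'e) multipole \<Rightarrow> bool" where
  "cubic_graph G \<longleftrightarrow> graph G \<and> (\<forall>v\<in>verts G. degree G v = 3)"

definition adjacent :: "('v, 'e) multipole \<Rightarrow> 'v \<Rightarrow> 'v \<Rightarrow> bool" where
  "adjacent G x y \<longleftrightarrow> (\<exists>e\<in>edges G. ends G e = {#x, y#})"

definition connected :: "('v, 'e) multipole \<Rightarrow> bool" where
  "connected G \<longleftrightarrow> verts G \<noteq> {} \<and> (\<forall>x\<in>verts G. \<forall>y\<in>verts G. (adjacent G)\<^sup>*\<^sup>* x y)"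

definition component_of :: "('v, 'e) multipole \<Rightarrow> 'v \<Rightarrow> ('v, 'e) multipole" where
  "component_of G x =
     (let C = {y \<in> verts G. (adjacent G)\<^sup>*\<^sup>* x y}
      in \<lparr>verts = C, edges = {e \<in> edges G. set_mset (ends G e) \<subseteq> C}, ends = ends G\<rparr>)"

definition components :: "('v, 'e) multipole \<Rightarrow> ('v, 'e) multipole set" where
  "components G = component_of G ` verts G"

text \<open>
  A loop is adjacent to itself, so a multipole with a loop has no proper edge-colouring. This is
  the convention under which a cubic graph is 3-edge-colourable iff it has a nowhere-zero 4-flow.
\<close>

definition proper_edge_colouring :: "nat \<Rightarrow> ('v, 'e) multipole \<Rightarrow> ('e \<Rightarrow> nat) \<Rightarrow> bool" where
  "proper_edge_colouring k M c \<longleftrightarrow>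
     (\<forall>e\<in>edges M. c e < k) \<and>
     (\<forall>e\<in>edges M. \<forall>v. count (ends M e) v \<le> 1) \<and>
     (\<forall>e\<in>edges M. \<forall>f\<in>edges M. e \<noteq> f \<and> set_mset (ends M e) \<inter> set_mset (ends M f) \<noteq> {}
        \<longrightarrow> c e \<noteq> c f)"

definition edge_colourable :: "nat \<Rightarrow> ('v, 'e) multipole \<Rightarrow> bool" where
  "edge_colourable k M \<longleftrightarrow> (\<exists>c. proper_edge_colouring k M c)"

text \<open>For a finite multipole the value is \<open>\<infinity>\<close> exactly if there is a loop.\<close>

definition chromatic_index :: "('v, 'e) multipole \<Rightarrow> enat" where
  "chromatic_index M = Inf (enat ` {k. edge_colourable k M})"

definition nowhere_zero_flow :: "nat \<Rightarrow> ('v, 'e) multipole \<Rightarrow> bool" where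
  "nowhere_zero_flow k G \<longleftrightarrow>
     (\<exists>(tail :: 'e \<Rightarrow> 'v) (head :: 'e \<Rightarrow> 'v) (\<phi> :: 'e \<Rightarrow> int).
        (\<forall>e\<in>edges G. ends G e = {#tail e, head e#}) \<and>
        (\<forall>e\<in>edges G. \<phi> e \<noteq> 0 \<and> \<bar>\<phi> e\<bar> < int k) \<and>
        (\<forall>v\<in>verts G. (\<Sum>e\<in>{e \<in> edges G. head e = v}. \<phi> e) =
                      (\<Sum>e\<in>{e \<in> edges G. tail e = v}. \<phi> e)))"

definition snark :: "('v, 'e) multipole \<Rightarrow> bool" where
  "snark G \<longleftrightarrow> cubic_graph G \<and> connected G \<and> \<not> edge_colourable 3 G"

definition remove_verts :: "('v, 'e) multipole \<Rightarrow> 'v set \<Rightarrow> ('v, 'e) multipole" where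
  "remove_verts G X =
     \<lparr>verts = verts G - X, edges = edges G, ends = (\<lambda>e. filter_mset (\<lambda>x. x \<notin> X) (ends G e))\<rparr>"

definition identify :: "('v, 'e) multipole \<Rightarrow> 'v \<Rightarrow> 'v \<Rightarrow> ('v, 'e) multipole" where
  "identify G u v =
     (let q = (\<lambda>x. if x = v then u else x)
      in \<lparr>verts = q ` verts G, edges = edges G, ends = (\<lambda>e. image_mset q (ends G e))\<rparr>)"

definition remove_edges :: "('v, 'e) multipole \<Rightarrow> 'e set \<Rightarrow> ('v, 'e) multipole" where
  "remove_edges G S = \<lparr>verts = verts G, edges = edges G - S, ends = ends G\<rparr>"

definition bicritical :: "('v, 'e) multipole \<Rightarrow> bool" where
  "bicritical G \<longleftrightarrow>
     (\<forall>u\<in>verts G. \<forall>v\<in>verts G. u \<noteq> v \<longrightarrow> edge_colourable 3 (remove_verts G {u, v}))"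

definition four_vertex_critical :: "('v, 'e) multipole \<Rightarrow> bool" where
  "four_vertex_critical G \<longleftrightarrow>
     (\<forall>u\<in>verts G. \<forall>v\<in>verts G. u \<noteq> v \<longrightarrow> nowhere_zero_flow 4 (identify G u v))"

definition completes :: "('v, 'e) multipole \<Rightarrow> ('v, 'e) multipole \<Rightarrow> bool" where
  "completes H K \<longleftrightarrow> cubic_graph H \<and> verts K \<subseteq> verts H \<and> edges K \<subseteq> edges H \<and>
     (\<forall>e\<in>edges K. ends H e = ends K e)"

text \<open>
  A component containing a loop has chromatic index \<open>\<infinity>\<close>; it is not 3-edge-colourable and is
  treated like one of chromatic index 4.

  Letting \<open>H\<close> have the same vertex and edge types as \<open>G\<close> loses no generality, even if these types
  are finite: as \<open>H\<close> is cubic and has fewer vertices than the cubic graph \<open>G\<close>, it also has fewer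
  edges, so the elements of \<open>H\<close> outside \<open>K\<close> can be renamed to elements of \<open>G\<close> outside \<open>K\<close>.
\<close>

definition k_irreducible :: "nat \<Rightarrow> ('v, 'e) multipole \<Rightarrow> bool" where
  "k_irreducible k G \<longleftrightarrow>
     \<not> (\<exists>S K H. S \<subseteq> edges G \<and> card S < k \<and> K \<in> components (remove_edges G S) \<and>
          chromatic_index K \<in> {4, \<infinity>} \<and> completes H K \<and> card (verts H) < card (verts G))"

definition irreducible :: "('v, 'e) multipole \<Rightarrow> bool" where
  "irreducible G \<longleftrightarrow> (\<forall>k\<ge>1. k_irreducible k G)"

end

theory Submission imports Defs begin

text \<open>
  A nowhere-zero 4-flow amounts to a covering of the edges by two even subgraphs. On
  \<open>G / {u, v}\<close> such a covering is the same as a 3-edge-colouring of \<open>G - {u, v}\<close>: the parity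
  condition at the merged vertex follows from those at the cubic vertices by handshaking.

  If \<open>G - {u, v}\<close> is not 3-edge-colourable, then neither is some component left after removing the
  at most six edges at \<open>u\<close> and \<open>v\<close>; greedy colouring shows that four colours suffice unless there
  is a loop, and joining up the missing degrees (with one extra vertex if the order is odd) gives a
  smaller cubic completion. Conversely, in a bicritical snark a component that is not
  3-edge-colourable misses at most one vertex, and as cubic graphs have even order it has no
  smaller completion.
\<close>

section \<open>Degrees within a set of edges, and handshaking\<close>

text \<open>The edge set is an argument of its own, so that parts of a cover, colour classes and
  greedy remainders can be treated without forming a new multipole.\<close>

definition degree_in :: "('v, 'e) multipole \<Rightarrow> 'e set \<Rightarrow> 'v \<Rightarrow> nat" where
  "degree_in M F x = (\<Sum>e\<in>F. count (ends M e) x)"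

lemma degree_eq_degree_in: "degree M x = degree_in M (edges M) x"
  by (simp add: degree_def degree_in_def)

lemma degree_in_remove:
  assumes "finite F" "e \<in> F"
  shows "degree_in M F x = count (ends M e) x + degree_in M (F - {e}) x"
  using assms by (simp add: degree_in_def sum.remove)

lemma degree_in_Un_disjoint:
  assumes "finite P" "finite Q" "P \<inter> Q = {}"
  shows "degree_in M (P \<union> Q) x = degree_in M P x + degree_in M Q x"
  using assms by (simp add: degree_in_def sum.union_disjoint)

lemma degree_in_mono:
  assumes "finite F" "F' \<subseteq> F"
  shows "degree_in M F' x \<le> degree_in M F x"
  unfolding degree_in_def by (rule sum_mono2) (use assms in auto)

lemma sum_degree_in:
  assumes "finite V" "\<And>e. e \<in> F \<Longrightarrow> set_mset (ends M e) \<subseteq> V"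
  shows "(\<Sum>x\<in>V. degree_in M F x) = (\<Sum>e\<in>F. size (ends M e))"
proof -
  have "(\<Sum>x\<in>V. count (ends M e) x) = size (ends M e)" if "e \<in> F" for e
    unfolding size_multiset_overloaded_eq
    by (rule sum.mono_neutral_right) (use assms that in \<open>auto simp: not_in_iff\<close>)
  then show ?thesis
    unfolding degree_in_def by (subst sum.swap) simp
qed

lemma mset_size_2:
  assumes "size N = 2"
  shows "\<exists>a b. N = {#a, b#}"
proof -
  obtain a N' where "N = add_mset a N'" "size N' = 1"
    using assms by (cases N) auto
  then show ?thesis by (metis size_1_singleton_mset)
qed

lemma graph_sum_degree_in:
  assumes "graph G" "F \<subseteq> edges G"
  shows "(\<Sum>x\<in>verts G. degree_in G F x) = 2 * card F"
proof -
  have "(\<Sum>x\<in>verts G. degree_in G F x) = (\<Sum>e\<in>F. size (ends G e))"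
    by (rule sum_degree_in) (use assms in \<open>auto simp: graph_def\<close>)
  also have "\<dots> = (\<Sum>e\<in>F. 2)"
    by (rule sum.cong) (use assms in \<open>auto simp: graph_def\<close>)
  finally show ?thesis by simp
qed

lemma cubic_graph_card:
  assumes "cubic_graph G"
  shows "3 * card (verts G) = 2 * card (edges G)"
  using graph_sum_degree_in[of G "edges G"] assms
  by (simp add: cubic_graph_def flip: degree_eq_degree_in)

lemma cubic_graph_even_card:
  assumes "cubic_graph G"
  shows "even (card (verts G))"
  using cubic_graph_card[OF assms] by presburger

subsection \<open>Nowhere-zero 4-flows and even subgraphs\<close>

text \<open>In contrast to separate sums for inflow and outflow, a single sum with signed incidences
  is visibly linear in \<open>\<phi>\<close>, cancels loops and can be reduced modulo 2 term by
  term.\<close>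

definition net_flow :: "'e set \<Rightarrow> ('e \<Rightarrow> 'v) \<Rightarrow> ('e \<Rightarrow> 'v) \<Rightarrow> ('e \<Rightarrow> int) \<Rightarrow> 'v \<Rightarrow> int" where
  "net_flow F tail head \<phi> x = (\<Sum>e\<in>F. \<phi> e * (of_bool (head e = x) - of_bool (tail e = x)))"

lemma net_flow_eq_diff:
  assumes "finite F"
  shows "net_flow F tail head \<phi> x
       = (\<Sum>e\<in>{e \<in> F. head e = x}. \<phi> e) - (\<Sum>e\<in>{e \<in> F. tail e = x}. \<phi> e)"
proof -
  have "net_flow F tail head \<phi> x
      = (\<Sum>e\<in>F. (if head e = x then \<phi> e else 0) - (if tail e = x then \<phi> e else 0))"
    unfolding net_flow_def by (rule sum.cong) auto
  then show ?thesis using assms by (simp add: sum_subtractf sum.inter_filter)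
qed

text \<open>
  Consecutive edges \<open>y \<rightarrow> x\<close> and \<open>x \<rightarrow> z\<close> are replaced by a single edge \<open>y \<rightarrow> z\<close>; this preserves
  the parity of all degrees and lets signs be pulled back.
\<close>

lemma balanced_signs:
  fixes tail head :: "'e \<Rightarrow> 'v"
  assumes "finite F"
    and "\<And>x. even (\<Sum>e\<in>F. of_bool (head e = x) + of_bool (tail e = x) :: nat)"
  shows "\<exists>\<sigma>. (\<forall>e\<in>F. \<sigma> e \<in> {1, -1}) \<and> (\<forall>x. net_flow F tail head \<sigma> x = 0)"
  using assms
proof (induction "card F" arbitrary: F tail head rule: less_induct)
  case less
  show ?case
  proof (cases "F = {}")
    case True
    then show ?thesis by (simp add: net_flow_def)
  next
    case False
    then obtain e where e: "e \<in> F" by auto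
    define F' where "F' = F - {e}"
    have F': "finite F'" "card F' < card F" "F = insert e F'" "e \<notin> F'"
      using e less.prems(1) card_Diff1_less[OF less.prems(1) e] by (auto simp: F'_def)
    have par: "even ((of_bool (head e = x) + of_bool (tail e = x)) +
       (\<Sum>e\<in>F'. of_bool (head e = x) + of_bool (tail e = x) :: nat))" for x
      using less.prems(2)[of x] F' by simp
    show ?thesis
    proof (cases "head e = tail e")
      case True
      \<comment> \<open>A loop adds 0 or 2 to each sum and nothing to the net flow, so it may be
        dropped and given the sign 1.\<close>
      have "even (\<Sum>e\<in>F'. of_bool (head e = x) + of_bool (tail e = x) :: nat)" for x
        using par[of x] True by simp
      from less.hyps[OF F'(2,1) this] obtain \<sigma> where
        \<sigma>: "\<forall>e\<in>F'. \<sigma> e \<in> {1, -1}" "\<forall>x. net_flow F' tail head \<sigma> x = 0" by blast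
      have "net_flow F tail head (\<sigma>(e := 1)) x = net_flow F' tail head \<sigma> x" for x
        unfolding net_flow_def F'(3) using F'(1,4) True by (simp, intro sum.cong) auto
      with \<sigma> have "(\<forall>i\<in>F. (\<sigma>(e := 1)) i \<in> {1, -1}) \<and> (\<forall>x. net_flow F tail head (\<sigma>(e := 1)) x = 0)"
        by (auto simp: F'(3))
      then show ?thesis by blast
    next
      case False
      define x where "x = head e"
      define y where "y = tail e"
      \<comment> \<open>\<open>e\<close> contributes exactly 1 at \<open>x\<close>, so the remaining
        sum there is odd and another edge \<open>f\<close> meets \<open>x\<close>.\<close>
      have "odd (\<Sum>e\<in>F'. of_bool (head e = x) + of_bool (tail e = x) :: nat)"
        using par[of x] False by (simp add: x_def)
      then have "(\<Sum>e\<in>F'. of_bool (head e = x) + of_bool (tail e = x) :: nat) \<noteq> 0"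
        by (metis even_zero)
      then obtain f where f: "f \<in> F'" "head f = x \<or> tail f = x"
        by (rule sum.not_neutral_contains_not_neutral) (auto split: if_splits)
      define z where "z = (if tail f = x then head f else tail f)"
      define F'' where "F'' = F' - {f}"
      have F'': "finite F''" "F' = insert f F''" "f \<notin> F''" "e \<notin> F''" "e \<noteq> f"
        using f F' by (auto simp: F''_def)
      \<comment> \<open>The name \<open>f\<close> is reused for the merged edge from
        \<open>y\<close> to \<open>z\<close>, so the induction hypothesis is applied to
        \<open>F'\<close>.\<close>
      define tail' where "tail' = tail(f := y)"
      define head' where "head' = head(f := z)"
      have rest: "(\<Sum>e\<in>F''. of_bool (head' e = w) + of_bool (tail' e = w) :: nat)
          = (\<Sum>e\<in>F''. of_bool (head e = w) + of_bool (tail e = w))" for w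
        by (intro sum.cong) (use F'' in \<open>auto simp: head'_def tail'_def\<close>)
      have "even (\<Sum>e\<in>F'. of_bool (head' e = w) + of_bool (tail' e = w) :: nat)" for w
      proof -
        have "of_bool (head f = w) + of_bool (tail f = w) = (of_bool (x = w) + of_bool (z = w) :: nat)"
          using f(2) by (auto simp: z_def)
        moreover have "(\<Sum>e\<in>F'. of_bool (head e = w) + of_bool (tail e = w) :: nat) =
            of_bool (head f = w) + of_bool (tail f = w) +
            (\<Sum>e\<in>F''. of_bool (head e = w) + of_bool (tail e = w))"
          unfolding F''(2) using F''(1,3) by simp
        ultimately have "even (of_bool (x = w) + of_bool (y = w) + (of_bool (x = w) + of_bool (z = w)) +
            (\<Sum>e\<in>F''. of_bool (head e = w) + of_bool (tail e = w) :: nat))"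
          using par[of w] unfolding x_def[symmetric] y_def[symmetric] by (simp only: add.assoc)
        moreover have "(\<Sum>e\<in>F'. of_bool (head' e = w) + of_bool (tail' e = w) :: nat)
            = of_bool (z = w) + of_bool (y = w) +
              (\<Sum>e\<in>F''. of_bool (head e = w) + of_bool (tail e = w))"
          unfolding F''(2) using F''(1,3) rest[of w] by (simp add: head'_def tail'_def)
        ultimately show ?thesis by presburger
      qed
      from less.hyps[OF F'(2,1) this] obtain \<sigma>' where
        \<sigma>': "\<forall>e\<in>F'. \<sigma>' e \<in> {1, -1}" "\<forall>x. net_flow F' tail' head' \<sigma>' x = 0" by blast
      \<comment> \<open>Both edges inherit the sign of the merged edge; for \<open>f\<close> it is
        negated if \<open>x\<close> is not its tail, as the merged edge then runs against
        \<open>f\<close>.\<close>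
      define \<sigma> where "\<sigma> = \<sigma>'(e := \<sigma>' f, f := if tail f = x then \<sigma>' f else - \<sigma>' f)"
      have "net_flow F tail head \<sigma> w = net_flow F' tail' head' \<sigma>' w" for w
      proof -
        have "net_flow F'' tail head \<sigma> w = net_flow F'' tail' head' \<sigma>' w"
          unfolding net_flow_def
          by (intro sum.cong) (use F'' in \<open>auto simp: head'_def tail'_def \<sigma>_def\<close>)
        moreover have "net_flow F tail head \<sigma> w =
            \<sigma> e * (of_bool (head e = w) - of_bool (tail e = w)) +
            (\<sigma> f * (of_bool (head f = w) - of_bool (tail f = w)) + net_flow F'' tail head \<sigma> w)"
          unfolding net_flow_def F'(3) F''(2) using F'' by simp
        moreover have "net_flow F' tail' head' \<sigma>' w =
            \<sigma>' f * (of_bool (z = w) - of_bool (y = w)) + net_flow F'' tail' head' \<sigma>' w"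
          unfolding net_flow_def F''(2) using F'' by (simp add: head'_def tail'_def)
        moreover have "\<sigma> e * (of_bool (head e = w) - of_bool (tail e = w)) +
            \<sigma> f * (of_bool (head f = w) - of_bool (tail f = w)) =
            \<sigma>' f * (of_bool (z = w) - of_bool (y = w))"
          using F''(5) f(2) by (auto simp: \<sigma>_def x_def y_def z_def)
        ultimately show ?thesis by simp
      qed
      moreover have "\<forall>i\<in>F. \<sigma> i \<in> {1, -1}"
        using \<sigma>'(1) F'(3) f(1) by (auto simp: \<sigma>_def)
      ultimately show ?thesis using \<sigma>'(2) by auto
    qed
  qed
qed

text \<open>Modulo 2 the signs vanish and only edges with odd \<open>\<phi>\<close> count; a loop
  contributes 0 to the net flow and 2 to the degree at its vertex.\<close>

lemma even_net_flow_iff: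
  assumes "finite F" "\<And>e. e \<in> F \<Longrightarrow> ends G e = {#tail e, head e#}"
  shows "even (net_flow F tail head \<phi> x) \<longleftrightarrow> even (degree_in G {e \<in> F. odd (\<phi> e)} x)"
proof -
  have "{e \<in> F. odd (\<phi> e * (of_bool (head e = x) - of_bool (tail e = x)))} =
        {e \<in> {e \<in> F. odd (\<phi> e)}. odd (count (ends G e) x)}"
    using assms(2) by (auto split: if_splits)
  then show ?thesis
    using assms(1) by (simp add: net_flow_def degree_in_def even_sum_iff)
qed

text \<open>The orientation is given in advance and reversals are expressed by the sign -1. Hence
  two even subgraphs receive flows for one and the same orientation, and these can be added.\<close>

lemma even_subgraph_signs:
  assumes "finite F" "\<And>e. e \<in> F \<Longrightarrow> ends G e = {#tail e, head e#}"
    and "\<And>x. even (degree_in G F x)"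
  obtains \<sigma> where "\<And>e. e \<in> F \<Longrightarrow> \<sigma> e \<in> {1, -1}" "\<And>x. net_flow F tail head \<sigma> x = 0"
proof -
  have "(\<Sum>e\<in>F. of_bool (head e = x) + of_bool (tail e = x) :: nat) = degree_in G F x" for x
    unfolding degree_in_def by (intro sum.cong) (auto simp: assms(2))
  then have "even (\<Sum>e\<in>F. of_bool (head e = x) + of_bool (tail e = x) :: nat)" for x
    using assms(3) by simp
  from balanced_signs[OF assms(1) this] that show ?thesis by blast
qed

lemma net_flow_extend:
  assumes "finite F" "F' \<subseteq> F"
  shows "net_flow F tail head (\<lambda>e. if e \<in> F' then \<sigma> e else 0) x = net_flow F' tail head \<sigma> x"
  unfolding net_flow_def by (rule sum.mono_neutral_cong_right) (use assms in auto)

lemma nowhere_zero_flow_iff_net_flow: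
  assumes "finite (edges G)"
  shows "nowhere_zero_flow k G \<longleftrightarrow>
    (\<exists>tail head \<phi>. (\<forall>e\<in>edges G. ends G e = {#tail e, head e#}) \<and>
       (\<forall>e\<in>edges G. \<phi> e \<noteq> 0 \<and> \<bar>\<phi> e\<bar> < int k) \<and>
       (\<forall>x\<in>verts G. net_flow (edges G) tail head \<phi> x = 0))"
  unfolding nowhere_zero_flow_def net_flow_eq_diff[OF assms] by simp

text \<open>From a flow, \<open>A\<close> is the set of edges with odd value. Adding balanced signs
  on \<open>A\<close> makes all values even; after halving, the edges with odd value form
  \<open>B\<close>, which contains every edge outside \<open>A\<close> because its value was 2 or
  -2. Conversely, combine unit flows as \<open>\<alpha>\<close> + 2\<open>\<beta>\<close>: the
  values are odd on \<open>A\<close>, equal to 2 or -2 elsewhere, and at most 3 in absolute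
  value.\<close>

lemma nowhere_zero_4_flow_iff_even_cover:
  assumes "graph G"
  shows "nowhere_zero_flow 4 G \<longleftrightarrow>
    (\<exists>A B. A \<union> B = edges G \<and> (\<forall>x. even (degree_in G A x)) \<and> (\<forall>x. even (degree_in G B x)))"
    (is "?L \<longleftrightarrow> ?R")
proof
  let ?E = "edges G"
  have fin: "finite ?E" and sub: "\<And>e. e \<in> ?E \<Longrightarrow> set_mset (ends G e) \<subseteq> verts G"
    using assms by (auto simp: graph_def)
  assume ?L
  then obtain tail head \<phi> where ends: "\<And>e. e \<in> ?E \<Longrightarrow> ends G e = {#tail e, head e#}"
    and \<phi>: "\<And>e. e \<in> ?E \<Longrightarrow> \<phi> e \<noteq> 0 \<and> \<bar>\<phi> e\<bar> < int 4"
    and cons: "\<And>x. x \<in> verts G \<Longrightarrow> net_flow ?E tail head \<phi> x = 0"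
    unfolding nowhere_zero_flow_iff_net_flow[OF fin] by blast
  \<comment> \<open>Even degrees are demanded at all \<open>x\<close>, and outside
    \<open>verts G\<close> no edge has an end.\<close>
  have cons': "net_flow ?E tail head \<phi> x = 0" for x
  proof (cases "x \<in> verts G")
    case False
    then have "head e \<noteq> x \<and> tail e \<noteq> x" if "e \<in> ?E" for e
      using sub[OF that] ends[OF that] by auto
    then show ?thesis by (simp add: net_flow_def)
  qed (rule cons)
  define A where "A = {e \<in> ?E. odd (\<phi> e)}"
  have A: "A \<subseteq> ?E" "finite A" using fin by (auto simp: A_def)
  have evA: "even (degree_in G A x)" for x
    using even_net_flow_iff[OF fin ends, of \<phi> x] cons'[of x] by (simp add: A_def)
  obtain \<sigma> where \<sigma>: "\<And>e. e \<in> A \<Longrightarrow> \<sigma> e \<in> {1, -1}" "\<And>x. net_flow A tail head \<sigma> x = 0"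
    using even_subgraph_signs[OF A(2) ends evA] A(1) by blast
  define \<psi> where "\<psi> e = (\<phi> e + (if e \<in> A then \<sigma> e else 0)) div 2" for e
  have \<psi>: "2 * \<psi> e = \<phi> e + (if e \<in> A then \<sigma> e else 0)" if "e \<in> ?E" for e
  proof -
    have "even (\<phi> e + (if e \<in> A then \<sigma> e else 0))"
      using \<sigma>(1)[of e] that by (auto simp: A_def)
    then show ?thesis by (simp add: \<psi>_def)
  qed
  have "2 * net_flow ?E tail head \<psi> x =
      net_flow ?E tail head \<phi> x + net_flow ?E tail head (\<lambda>e. if e \<in> A then \<sigma> e else 0) x" for x
    unfolding net_flow_def sum_distrib_left sum.distrib[symmetric]
    by (intro sum.cong refl) (metis \<psi> distrib_right mult.assoc)
  then have \<psi>0: "net_flow ?E tail head \<psi> x = 0" for x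
    using cons' \<sigma>(2) net_flow_extend[OF fin A(1)] by (metis add_0 mult_eq_0_iff zero_neq_numeral)
  define B where "B = {e \<in> ?E. odd (\<psi> e)}"
  have evB: "even (degree_in G B x)" for x
    using even_net_flow_iff[OF fin ends, of \<psi> x] \<psi>0[of x] by (simp add: B_def)
  have "e \<in> B" if "e \<in> ?E" "e \<notin> A" for e
  proof -
    have "even (\<phi> e)" "2 * \<psi> e = \<phi> e" using that \<psi>[of e] by (auto simp: A_def)
    with \<phi>[OF that(1)] have "\<psi> e = 1 \<or> \<psi> e = -1" by auto
    with that(1) show ?thesis by (auto simp: B_def)
  qed
  then have "A \<union> B = ?E" using A(1) by (auto simp: B_def)
  with evA evB show ?R by blast
next
  let ?E = "edges G"
  have fin: "finite ?E" using assms by (simp add: graph_def)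
  assume ?R
  then obtain A B where AB: "A \<union> B = ?E" "\<And>x. even (degree_in G A x)"
    "\<And>x. even (degree_in G B x)" by blast
  have "\<forall>e\<in>?E. \<exists>a b. ends G e = {#a, b#}"
    using assms unfolding graph_def by (metis mset_size_2)
  then obtain tail head where ends: "\<And>e. e \<in> ?E \<Longrightarrow> ends G e = {#tail e, head e#}"
    by metis
  have sub: "A \<subseteq> ?E" "B \<subseteq> ?E" "finite A" "finite B"
    using AB(1) fin by (auto intro: finite_subset)
  obtain \<alpha> where \<alpha>: "\<And>e. e \<in> A \<Longrightarrow> \<alpha> e \<in> {1, -1}" "\<And>x. net_flow A tail head \<alpha> x = 0"
    using even_subgraph_signs[OF sub(3) ends AB(2)] sub(1) by blast
  obtain \<beta> where \<beta>: "\<And>e. e \<in> B \<Longrightarrow> \<beta> e \<in> {1, -1}" "\<And>x. net_flow B tail head \<beta> x = 0"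
    using even_subgraph_signs[OF sub(4) ends AB(3)] sub(2) by blast
  let ?a = "\<lambda>e. if e \<in> A then \<alpha> e else 0" and ?b = "\<lambda>e. if e \<in> B then \<beta> e else 0"
  define \<phi> where "\<phi> e = ?a e + 2 * ?b e" for e
  have "net_flow ?E tail head \<phi> x = net_flow ?E tail head ?a x + 2 * net_flow ?E tail head ?b x"
    for x
    unfolding net_flow_def sum_distrib_left sum.distrib[symmetric]
    by (intro sum.cong refl) (simp add: \<phi>_def distrib_right)
  then have "net_flow ?E tail head \<phi> x = 0" for x
    using \<alpha>(2) \<beta>(2)
    by (simp add: net_flow_extend[OF fin sub(1)] net_flow_extend[OF fin sub(2)] del: if_split)
  moreover have "\<phi> e \<noteq> 0 \<and> \<bar>\<phi> e\<bar> < int 4" if "e \<in> ?E" for e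
    using that AB(1) \<alpha>(1)[of e] \<beta>(1)[of e] by (auto simp: \<phi>_def)
  ultimately show ?L
    unfolding nowhere_zero_flow_iff_net_flow[OF fin] using ends by blast
qed

subsection \<open>Colourings and even covers\<close>

text \<open>
  At a vertex of degree 3 a colouring is proper iff each of the three colour classes has degree 1
  there; if the unions of two pairs of classes have even degree, all three class degrees are odd.
\<close>

lemma proper_3_edge_colouring_iff:
  assumes "finite (edges M)" "\<And>e. e \<in> edges M \<Longrightarrow> set_mset (ends M e) \<subseteq> verts M"
    and "\<And>x. x \<in> verts M \<Longrightarrow> degree M x = 3"
  shows "proper_edge_colouring 3 M c \<longleftrightarrow> (\<forall>e\<in>edges M. c e < 3) \<and>
    (\<forall>x\<in>verts M. \<forall>i<3. degree_in M {e \<in> edges M. c e = i} x = 1)" (is "?L \<longleftrightarrow> ?R")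
proof
  let ?C = "\<lambda>i. {e \<in> edges M. c e = i}"
  assume L: ?L
  then have lt: "\<forall>e\<in>edges M. c e < 3" by (simp add: proper_edge_colouring_def)
  have "degree_in M (?C i) x = 1" if x: "x \<in> verts M" and i: "i < 3" for x i
  proof -
    have le: "degree_in M (?C j) x \<le> 1" for j
    proof (cases "\<exists>e\<in>?C j. x \<in># ends M e")
      case True
      then obtain e where e: "e \<in> ?C j" "x \<in># ends M e" by blast
      have "x \<notin># ends M f" if "f \<in> ?C j - {e}" for f
        using L that e unfolding proper_edge_colouring_def
        by (metis (mono_tags, lifting) DiffE disjoint_iff mem_Collect_eq singletonI)
      then have "degree_in M (?C j - {e}) x = 0"
        by (simp add: degree_in_def not_in_iff)
      moreover have "count (ends M e) x \<le> 1"
        using L e(1) by (simp add: proper_edge_colouring_def)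
      ultimately show ?thesis
        using degree_in_remove[of "?C j" e M x] e(1) assms(1) by simp
    next
      case False
      then show ?thesis by (simp add: degree_in_def not_in_iff)
    qed
    have "{i. i < (3::nat)} = {0, 1, 2}" by auto
    \<comment> \<open>The three classes make up the degree 3 and each contributes at most 1, so each
      contributes exactly 1.\<close>
    moreover have "(\<Sum>j | j < 3. degree_in M (?C j) x) = degree M x"
      unfolding degree_in_def degree_def
      by (rule sum.group) (use assms(1) lt in auto)
    ultimately have "degree_in M (?C 0) x + degree_in M (?C 1) x + degree_in M (?C 2) x = 3"
      using assms(3)[OF x] by simp
    moreover have "i = 0 \<or> i = 1 \<or> i = 2" using i by auto
    ultimately show ?thesis
      using le[of 0] le[of 1] le[of 2] by auto
  qed
  with lt show ?R by blast
next
  let ?C = "\<lambda>i. {e \<in> edges M. c e = i}"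
  assume R: ?R
  \<comment> \<open>This single bound excludes both a loop at \<open>x\<close> and a second edge of
    the same colour at an end \<open>x\<close> of \<open>e\<close>.\<close>
  have one: "count (ends M e) x + degree_in M (?C (c e) - {e}) x \<le> 1" if "e \<in> edges M" for e x
  proof (cases "x \<in> verts M")
    case True
    then show ?thesis
      using R that degree_in_remove[of "?C (c e)" e M x] assms(1) by auto
  next
    case False
    then have "x \<notin># ends M f" if "f \<in> edges M" for f using assms(2)[OF that] by auto
    then show ?thesis using that by (simp add: degree_in_def not_in_iff)
  qed
  have "c e \<noteq> c f" if "e \<in> edges M" "f \<in> edges M" "e \<noteq> f" "x \<in># ends M e" "x \<in># ends M f" for e f x
  proof
    assume "c e = c f"
    then have "count (ends M f) x \<le> degree_in M (?C (c e) - {e}) x"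
      using degree_in_remove[of "?C (c e) - {e}" f M x] that assms(1) by auto
    moreover have "count (ends M e) x > 0" "count (ends M f) x > 0" using that(4,5) by simp_all
    ultimately show False
      using one[OF that(1), of x] by linarith
  qed
  moreover have "count (ends M e) x \<le> 1" if "e \<in> edges M" for e x
    using one[OF that, of x] by simp
  ultimately show ?L
    using R unfolding proper_edge_colouring_def by blast
qed

lemma graph_identify:
  assumes "graph G" "u \<in> verts G"
  shows "graph (identify G u v)"
  using assms by (auto simp: graph_def identify_def Let_def)

lemma degree_in_remove_verts:
  assumes "x \<notin> X"
  shows "degree_in (remove_verts G X) F x = degree_in G F x"
  using assms by (simp add: degree_in_def remove_verts_def)

lemma degree_in_identify:
  assumes "x \<noteq> u" "x \<noteq> v"
  shows "degree_in (identify G u v) F x = degree_in G F x"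
proof -
  have "count (image_mset (\<lambda>x. if x = v then u else x) N) x = count N x" for N
    using assms by (induction N) auto
  then show ?thesis by (simp add: degree_in_def identify_def Let_def)
qed

text \<open>The colours correspond to \<open>A \<inter> B\<close>, \<open>A - B\<close> and
  \<open>B - A\<close>; in the other direction \<open>A\<close> and \<open>B\<close> are the unions
  of colour 0 with colour 1 and with colour 2. Identifying and removing vertices both keep the edge
  set of \<open>G\<close>, so the same sets serve on both sides.\<close>

lemma even_cover_iff_colourable:
  assumes G: "cubic_graph G" and uv: "u \<in> verts G" "v \<in> verts G"
  shows "(\<exists>A B. A \<union> B = edges G \<and> (\<forall>x. even (degree_in (identify G u v) A x)) \<and>
      (\<forall>x. even (degree_in (identify G u v) B x))) \<longleftrightarrow> edge_colourable 3 (remove_verts G {u, v})"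
    (is "?L \<longleftrightarrow> ?R")
proof -
  let ?M = "remove_verts G {u, v}" and ?I = "identify G u v"
  have gr: "graph G" and fin: "finite (edges G)" using G by (auto simp: cubic_graph_def graph_def)
  have M: "edges ?M = edges G" "verts ?M = verts G - {u, v}" by (simp_all add: remove_verts_def)
  have deg3: "degree_in G (edges G) x = 3" if "x \<in> verts G" for x
    using G that by (simp add: cubic_graph_def degree_eq_degree_in)
  have pc: "proper_edge_colouring 3 ?M c \<longleftrightarrow> (\<forall>e\<in>edges G. c e < 3) \<and>
      (\<forall>x\<in>verts G - {u, v}. \<forall>i<3. degree_in G {e \<in> edges G. c e = i} x = 1)" for c
  proof (subst proper_3_edge_colouring_iff)
    show "set_mset (ends ?M e) \<subseteq> verts ?M" if "e \<in> edges ?M" for e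
      using that gr by (auto simp: remove_verts_def graph_def)
  qed (use fin deg3 in \<open>auto simp: M degree_eq_degree_in degree_in_remove_verts\<close>)
  show ?thesis
  proof
    assume ?L
    then obtain A B where AB: "A \<union> B = edges G" "\<And>x. even (degree_in ?I A x)"
      "\<And>x. even (degree_in ?I B x)" by blast
    define c where "c e = (if e \<in> A then if e \<in> B then 0 else 1 else 2::nat)" for e
    have "degree_in G {e \<in> edges G. c e = i} x = 1" if x: "x \<in> verts G - {u, v}" and i: "i < 3" for x i
    proof -
      let ?d = "\<lambda>i. degree_in G {e \<in> edges G. c e = i} x"
      have "A = {e \<in> edges G. c e = 0} \<union> {e \<in> edges G. c e = 1}"
        using AB(1) by (auto simp: c_def split: if_splits)
      then have 1: "degree_in G A x = ?d 0 + ?d 1"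
        using fin by (auto intro!: degree_in_Un_disjoint)
      have "B = {e \<in> edges G. c e = 0} \<union> {e \<in> edges G. c e = 2}"
        using AB(1) by (auto simp: c_def split: if_splits)
      then have 2: "degree_in G B x = ?d 0 + ?d 2"
        using fin by (auto intro!: degree_in_Un_disjoint)
      have "edges G = A \<union> {e \<in> edges G. c e = 2}" "A \<inter> {e \<in> edges G. c e = 2} = {}"
        using AB(1) by (auto simp: c_def split: if_splits)
      then have 3: "?d 0 + ?d 1 + ?d 2 = 3"
        using degree_in_Un_disjoint[of A "{e \<in> edges G. c e = 2}" G x] 1 deg3[of x] x
          finite_subset[of A "edges G"] AB(1) fin by auto
      have "even (degree_in G A x)" "even (degree_in G B x)"
        using AB(2)[of x] AB(3)[of x] x by (simp_all add: degree_in_identify)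
      \<comment> \<open>\<open>?d 0 + ?d 1\<close> and \<open>?d 0 + ?d 2\<close> are even and the
        total is 3, so \<open>?d 2\<close> and \<open>?d 1\<close> are odd, and then so is
        \<open>?d 0\<close>.\<close>
      then have "odd (?d 2)" "odd (?d 1)" "odd (?d 0)"
        using 1 2 3 by presburger+
      then have "?d 0 \<ge> 1" "?d 1 \<ge> 1" "?d 2 \<ge> 1"
        using odd_pos by (metis One_nat_def Suc_leI)+
      moreover have "i = 0 \<or> i = 1 \<or> i = 2" using i by auto
      ultimately show ?thesis using 3 by auto
    qed
    then have "proper_edge_colouring 3 ?M c" unfolding pc by (auto simp: c_def)
    then show ?R unfolding edge_colourable_def by blast
  next
    assume ?R
    then obtain c :: "_ \<Rightarrow> nat" where lt: "\<forall>e\<in>edges G. c e < 3"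
      and one: "\<And>x i. x \<in> verts G \<Longrightarrow> x \<noteq> u \<Longrightarrow> x \<noteq> v \<Longrightarrow> i < 3 \<Longrightarrow>
        degree_in G {e \<in> edges G. c e = i} x = 1"
      unfolding edge_colourable_def pc by blast
    have ev: "even (degree_in ?I {e \<in> edges G. c e = i \<or> c e = j} x)"
      if ij: "i < 3" "j < 3" "i \<noteq> j" for i j x
    proof -
      let ?F = "{e \<in> edges G. c e = i \<or> c e = j}"
      have I: "graph ?I" "edges ?I = edges G" "verts ?I \<subseteq> verts G" "v \<in> verts ?I \<Longrightarrow> v = u"
        "u \<in> verts ?I"
        subgoal by (rule graph_identify[OF gr uv(1)])
        using uv by (auto simp: identify_def Let_def)
      \<comment> \<open>\<open>v\<close> is no vertex of the identified graph unless it equals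
        \<open>u\<close>, yet evenness is demanded at every \<open>x\<close>.\<close>
      have out: "degree_in ?I ?F y = 0" if "y \<notin> verts ?I" for y
      proof -
        have "y \<notin># ends ?I e" if "e \<in> edges G" for e
          using I(1,2) that \<open>y \<notin> verts ?I\<close> by (auto simp: graph_def)
        then show ?thesis by (simp add: degree_in_def not_in_iff)
      qed
      have in_ev: "even (degree_in ?I ?F y)" if "y \<in> verts ?I - {u}" for y
      proof -
        have y: "y \<in> verts G" "y \<noteq> u" "y \<noteq> v" using that I(3,4) by auto
        have "?F = {e \<in> edges G. c e = i} \<union> {e \<in> edges G. c e = j}" by auto
        then have "degree_in G ?F y =
            degree_in G {e \<in> edges G. c e = i} y + degree_in G {e \<in> edges G. c e = j} y"
          using fin ij(3) by (auto intro!: degree_in_Un_disjoint)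
        with one[OF y ij(1)] one[OF y ij(2)] y show ?thesis by (simp add: degree_in_identify)
      qed
      have parity: "even a" if "s = 2 * n" "s = a + r" "even r" for s n a r :: nat
        using that by presburger
      \<comment> \<open>Handshaking: the degree sum is even, and so are all its terms except
        possibly the one at the merged vertex \<open>u\<close>.\<close>
      have "(\<Sum>y\<in>verts ?I. degree_in ?I ?F y) = 2 * card ?F"
        by (rule graph_sum_degree_in) (use I in auto)
      moreover have "(\<Sum>y\<in>verts ?I. degree_in ?I ?F y) =
          degree_in ?I ?F u + (\<Sum>y\<in>verts ?I - {u}. degree_in ?I ?F y)"
        by (rule sum.remove) (use I in \<open>auto simp: graph_def\<close>)
      moreover have "even (\<Sum>y\<in>verts ?I - {u}. degree_in ?I ?F y)"
        using in_ev by (rule dvd_sum)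
      ultimately have u_ev: "even (degree_in ?I ?F u)" by (rule parity)
      show ?thesis
      proof (cases "x \<in> verts ?I")
        case True
        then show ?thesis using u_ev in_ev[of x] by blast
      next
        case False
        then show ?thesis unfolding out[OF False] by simp
      qed
    qed
    have "{e \<in> edges G. c e = 0 \<or> c e = 1} \<union> {e \<in> edges G. c e = 0 \<or> c e = 2} = edges G"
      using lt by fastforce
    moreover have "even (degree_in ?I {e \<in> edges G. c e = 0 \<or> c e = 1} x)"
      "even (degree_in ?I {e \<in> edges G. c e = 0 \<or> c e = 2} x)" for x
      by (rule ev; simp)+
    ultimately show ?L by blast
  qed
qed

lemma bicritical_iff_four_vertex_critical:
  assumes "cubic_graph G"
  shows "bicritical G \<longleftrightarrow> four_vertex_critical G"
proof -
  have "nowhere_zero_flow 4 (identify G u v) \<longleftrightarrow> edge_colourable 3 (remove_verts G {u, v})"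
    if "u \<in> verts G" "v \<in> verts G" for u v
  proof -
    have "edges (identify G u v) = edges G" by (simp add: identify_def Let_def)
    then show ?thesis
      using nowhere_zero_4_flow_iff_even_cover[OF graph_identify[of G u v]]
        even_cover_iff_colourable[OF assms that] assms that by (simp add: cubic_graph_def)
  qed
  then show ?thesis by (simp add: bicritical_def four_vertex_critical_def)
qed

subsection \<open>Greedy colouring\<close>

lemma edge_colourable_mono:
  assumes "edge_colourable k M" "k \<le> l" "edges N \<subseteq> edges M"
    and "\<And>e. e \<in> edges N \<Longrightarrow> ends N e = ends M e"
  shows "edge_colourable l N"
proof -
  obtain c where "proper_edge_colouring k M c"
    using assms(1) by (auto simp: edge_colourable_def)
  then have "proper_edge_colouring l N c"
    using assms(2,3,4) unfolding proper_edge_colouring_def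
    by (metis (no_types, lifting) order_less_le_trans subsetD)
  then show ?thesis by (auto simp: edge_colourable_def)
qed

text \<open>Every coloured edge sharing an end with \<open>e\<close> is counted in the degree sum,
  so fewer than \<open>k\<close> colours are forbidden for \<open>e\<close> and one is free.\<close>

lemma edge_colourable_extend:
  assumes "finite F" "e \<in> F" "edge_colourable k (M\<lparr>edges := F - {e}\<rparr>)"
    and no_loop: "\<And>x. count (ends M e) x \<le> 1"
    and few: "(\<Sum>x\<in>set_mset (ends M e). degree_in M (F - {e}) x) < k"
  shows "edge_colourable k (M\<lparr>edges := F\<rparr>)"
proof -
  obtain c where c: "proper_edge_colouring k (M\<lparr>edges := F - {e}\<rparr>) c"
    using assms(3) by (auto simp: edge_colourable_def)
  define N where "N x = {f \<in> F - {e}. x \<in># ends M f}" for x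
  define A where "A = (\<Union>x\<in>set_mset (ends M e). N x)"
  have finN: "finite (N x)" for x using assms(1) by (simp add: N_def)
  have "card (N x) \<le> degree_in M (F - {e}) x" for x
  proof -
    have "card (N x) = (\<Sum>f\<in>N x. 1)" by simp
    also have "\<dots> \<le> (\<Sum>f\<in>N x. count (ends M f) x)"
      by (rule sum_mono) (simp add: N_def Suc_le_eq)
    also have "\<dots> \<le> degree_in M (F - {e}) x"
      unfolding degree_in_def by (rule sum_mono2) (use assms(1) in \<open>auto simp: N_def\<close>)
    finally show ?thesis .
  qed
  then have "card A \<le> (\<Sum>x\<in>set_mset (ends M e). degree_in M (F - {e}) x)"
    unfolding A_def by (intro order_trans[OF card_UN_le] sum_mono) auto
  moreover have "card (c ` A) \<le> card A"
    by (rule card_image_le) (simp add: A_def finN)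
  ultimately have "card (c ` A) < card {..<k}" using few by simp
  then have "\<not> {..<k} \<subseteq> c ` A"
    by (metis A_def card_mono finN finite_UN finite_imageI finite_set_mset not_le)
  then obtain i where i: "i < k" "i \<notin> c ` A" by auto
  have diff: "c f \<noteq> i" if "f \<in> F - {e}" "set_mset (ends M e) \<inter> set_mset (ends M f) \<noteq> {}" for f
    using i(2) that by (auto simp: A_def N_def)
  have "proper_edge_colouring k (M\<lparr>edges := F\<rparr>) (c(e := i))"
    using c i(1) no_loop diff unfolding proper_edge_colouring_def
    by (auto simp: Int_commute)
  then show ?thesis by (auto simp: edge_colourable_def)
qed

text \<open>The edges outside \<open>F\<^sub>0\<close> are peeled off one at a time and coloured in
  reverse order. Asking for a suitable edge in every intermediate \<open>F'\<close> lets the choice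
  depend on what is left.\<close>

lemma edge_colourable_greedy:
  assumes "finite F" "F\<^sub>0 \<subseteq> F" "edge_colourable k (M\<lparr>edges := F\<^sub>0\<rparr>)"
    and "\<And>F'. F\<^sub>0 \<subset> F' \<Longrightarrow> F' \<subseteq> F \<Longrightarrow> \<exists>e\<in>F' - F\<^sub>0. (\<forall>x. count (ends M e) x \<le> 1) \<and>
      (\<Sum>x\<in>set_mset (ends M e). degree_in M (F' - {e}) x) < k"
  shows "edge_colourable k (M\<lparr>edges := F\<rparr>)"
  using assms
proof (induction F rule: finite_psubset_induct)
  case (psubset F)
  show ?case
  proof (cases "F = F\<^sub>0")
    case True
    then show ?thesis using psubset.prems(2) by simp
  next
    case False
    then have "F\<^sub>0 \<subset> F" using psubset.prems(1) by blast
    then obtain e where e: "e \<in> F - F\<^sub>0" "\<And>x. count (ends M e) x \<le> 1"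
      "(\<Sum>x\<in>set_mset (ends M e). degree_in M (F - {e}) x) < k"
      using psubset.prems(3)[of F] by blast
    have "edge_colourable k (M\<lparr>edges := F - {e}\<rparr>)"
    proof (rule psubset.IH)
      show "\<exists>e\<in>F' - F\<^sub>0. (\<forall>x. count (ends M e) x \<le> 1) \<and>
          (\<Sum>x\<in>set_mset (ends M e). degree_in M (F' - {e}) x) < k"
        if "F\<^sub>0 \<subset> F'" "F' \<subseteq> F - {e}" for F'
        using psubset.prems(3) that by blast
    qed (use e(1) psubset.prems(1,2) in auto)
    with e psubset.hyps show ?thesis by (intro edge_colourable_extend) auto
  qed
qed

text \<open>
  If every vertex met by a set of edges had degree 3 in it, the set would span a whole component
  of the graph.
\<close>

lemma four_edge_colourable_avoiding_vertex:
  assumes G: "cubic_graph G" "connected G" and F: "F \<subseteq> edges G"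
    and no_loop: "\<And>e x. e \<in> F \<Longrightarrow> count (ends G e) x \<le> 1"
    and u: "u \<in> verts G" "\<And>e. e \<in> F \<Longrightarrow> u \<notin># ends G e"
  shows "edge_colourable 4 (G\<lparr>edges := F\<rparr>)"
proof (rule edge_colourable_greedy)
  have gr: "graph G" and fin: "finite (edges G)"
    and deg3: "\<And>x. x \<in> verts G \<Longrightarrow> degree_in G (edges G) x = 3"
    using G by (auto simp: cubic_graph_def graph_def degree_eq_degree_in)
  show "finite F" using F fin by (rule finite_subset)
  show "edge_colourable 4 (G\<lparr>edges := {}\<rparr>)"
    by (simp add: edge_colourable_def proper_edge_colouring_def)
  fix F' assume F': "{} \<subset> F'" "F' \<subseteq> F"
  have finF': "finite F'" using F' F fin by (meson finite_subset)
  define T where "T = {x. \<exists>e\<in>F'. x \<in># ends G e}"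
  have TV: "T \<subseteq> verts G" using gr F F'(2) unfolding T_def graph_def by blast
  have "\<exists>a\<in>T. degree_in G F' a \<noteq> 3"
  proof (rule ccontr)
    assume "\<not> ?thesis"
    then have full: "degree_in G F' a = 3" if "a \<in> T" for a using that by blast
    \<comment> \<open>Full degree in \<open>F'\<close> forces every edge of \<open>G\<close> at
      \<open>a\<close> into \<open>F'\<close>. So \<open>T\<close> is closed under adjacency and, by
      connectedness, reaches \<open>u\<close>, which no edge of \<open>F\<close> meets.\<close>
    have closed: "b \<in> T" if "a \<in> T" and ab: "adjacent G a b" for a b
    proof -
      obtain f where f: "f \<in> edges G" "ends G f = {#a, b#}"
        using ab by (auto simp: adjacent_def)
      have "f \<in> F'"
      proof (rule ccontr)
        assume "f \<notin> F'"
        then have "degree_in G F' a \<le> degree_in G (edges G - {f}) a"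
          using F F' fin by (intro degree_in_mono) auto
        moreover have "degree_in G (edges G) a = 3" using deg3 TV \<open>a \<in> T\<close> by blast
        ultimately show False
          using degree_in_remove[OF fin f(1), of G a] f(2) full[OF \<open>a \<in> T\<close>] by simp
      qed
      with f show ?thesis unfolding T_def by force
    qed
    obtain e where e: "e \<in> F'" using F' by blast
    then have "size (ends G e) = 2" using gr F F' by (auto simp: graph_def)
    then obtain a where a: "a \<in># ends G e" by (metis mset_size_2 union_single_eq_member)
    then have aT: "a \<in> T" using e by (auto simp: T_def)
    have "(adjacent G)\<^sup>*\<^sup>* a u" using G(2) u(1) aT TV by (auto simp: connected_def)
    then have "u \<in> T" by (induction rule: rtranclp_induct) (use aT closed in auto)
    then show False using u(2) F' by (auto simp: T_def)
  qed
  then obtain a e where a: "degree_in G F' a \<noteq> 3" and e: "e \<in> F'" "a \<in># ends G e"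
    by (auto simp: T_def)
  have eG: "e \<in> edges G" using e F F' by auto
  then obtain b where b: "ends G e = {#a, b#}"
    using gr e(2) mset_size_2[of "ends G e"] by (auto simp: graph_def add_mset_commute)
  have ab: "a \<noteq> b" "a \<in> verts G" "b \<in> verts G"
    using no_loop[of e a] e F' b gr eG by (auto simp: graph_def)
  have "degree_in G F' x \<le> 3" if "x \<in> verts G" for x
    using degree_in_mono[OF fin, of F' G x] F F' deg3[OF that] by auto
  \<comment> \<open>Besides \<open>e\<close>, at most one edge of \<open>F'\<close> remains at
    \<open>a\<close> and at most two at \<open>b\<close>, so at most three colours are
    blocked.\<close>
  then have "degree_in G F' a \<le> 2" "degree_in G F' b \<le> 3" using a ab by fastforce+
  then have "degree_in G (F' - {e}) a \<le> 1" "degree_in G (F' - {e}) b \<le> 2"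
    using degree_in_remove[OF finF' e(1), of G a] degree_in_remove[OF finF' e(1), of G b] b ab(1)
    by auto
  then have "(\<Sum>x\<in>set_mset (ends G e). degree_in G (F' - {e}) x) < 4"
    using b ab(1) by simp
  then show "\<exists>e\<in>F' - {}. (\<forall>x. count (ends G e) x \<le> 1) \<and>
      (\<Sum>x\<in>set_mset (ends G e). degree_in G (F' - {e}) x) < 4"
    using e(1) no_loop F' by blast
qed simp

text \<open>Only the edges at \<open>X\<close> remain to be coloured. After the removal of
  \<open>X\<close> such an edge keeps at most one end, where it competes with at most two other
  edges, so three colours suffice greedily.\<close>

lemma edge_colourable_remove_verts:
  assumes G: "cubic_graph G"
    and col: "edge_colourable 3 (remove_edges G {e \<in> edges G. \<exists>x\<in>X. x \<in># ends G e})"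
      (is "edge_colourable 3 (remove_edges G ?S)")
  shows "edge_colourable 3 (remove_verts G X)"
proof -
  let ?M = "remove_verts G X"
  have gr: "graph G" and fin: "finite (edges G)"
    and deg3: "\<And>x. x \<in> verts G \<Longrightarrow> degree_in G (edges G) x = 3"
    using G by (auto simp: cubic_graph_def graph_def degree_eq_degree_in)
  have "edge_colourable 3 (?M\<lparr>edges := edges G\<rparr>)"
  proof (rule edge_colourable_greedy)
    show "edge_colourable 3 (?M\<lparr>edges := edges G - ?S\<rparr>)"
    proof (rule edge_colourable_mono[OF col])
      fix e assume "e \<in> edges (?M\<lparr>edges := edges G - ?S\<rparr>)"
      then have "\<forall>x. x \<in># ends G e \<longrightarrow> x \<notin> X" by auto
      then show "ends (?M\<lparr>edges := edges G - ?S\<rparr>) e = ends (remove_edges G ?S) e"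
        by (simp add: remove_verts_def remove_edges_def filter_mset_eq_conv)
    qed (simp_all add: remove_edges_def)
    fix F' assume F': "edges G - ?S \<subset> F'" "F' \<subseteq> edges G"
    then obtain e where e: "e \<in> F'" "e \<in> ?S" by blast
    have finF': "finite F'" using F' fin by (meson finite_subset)
    obtain y where y: "y \<in> X" "y \<in># ends G e" using e(2) by blast
    have "size (ends G e) = 2" using gr e F' by (auto simp: graph_def)
    then obtain z where z: "ends G e = {#y, z#}"
      using y(2) mset_size_2[of "ends G e"] by (auto simp: add_mset_commute)
    \<comment> \<open>If \<open>z\<close> lies in \<open>X\<close> too, for instance if
      \<open>e\<close> is a loop at \<open>y\<close>, no end is left and any colour will do.\<close>
    have endsM: "ends ?M e = (if z \<in> X then {#} else {#z#})"
      using y(1) z by (simp add: remove_verts_def)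
    have "(\<Sum>x\<in>set_mset (ends ?M e). degree_in ?M (F' - {e}) x) < 3"
    proof (cases "z \<in> X")
      case False
      have "z \<in> verts G" using gr e F' z by (auto simp: graph_def)
      then have "degree_in G F' z \<le> 3" using degree_in_mono[OF fin F'(2), of G z] deg3 by simp
      moreover have "y \<noteq> z" using y False by auto
      ultimately have "degree_in G (F' - {e}) z < 3"
        using degree_in_remove[OF finF' e(1), of G z] z by simp
      with False show ?thesis by (simp add: endsM degree_in_remove_verts)
    qed (simp add: endsM)
    moreover have "\<forall>x. count (ends ?M e) x \<le> 1" by (simp add: endsM)
    ultimately show "\<exists>e\<in>F' - (edges G - ?S). (\<forall>x. count (ends ?M e) x \<le> 1) \<and>
        (\<Sum>x\<in>set_mset (ends ?M e). degree_in ?M (F' - {e}) x) < 3"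
      using e by blast
  qed (use fin in auto)
  then show ?thesis by (rule edge_colourable_mono) (simp_all add: remove_verts_def)
qed

subsection \<open>Components\<close>

lemma adjacent_sym: "adjacent G x y \<Longrightarrow> adjacent G y x"
  unfolding adjacent_def by (metis add_mset_commute)

lemma component_of_eq:
  assumes "adjacent G x y"
  shows "component_of G x = component_of G y"
proof -
  have "(adjacent G)\<^sup>*\<^sup>* x z \<longleftrightarrow> (adjacent G)\<^sup>*\<^sup>* y z" for z
    by (meson assms adjacent_sym converse_rtranclp_into_rtranclp)
  then show ?thesis by (simp add: component_of_def)
qed

text \<open>One colouring is chosen per component; edges with a common end lie in the same
  component, so their colours come from the same choice. As only components through an end of an
  edge are considered, a failure of the conclusion yields one that contains an edge.\<close>

lemma edge_colourable_components:
  fixes G :: "('a, 'b) multipole"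
  assumes G: "\<And>e. e \<in> edges G \<Longrightarrow> size (ends G e) = 2 \<and> set_mset (ends G e) \<subseteq> verts G"
    and col: "\<And>e x. e \<in> edges G \<Longrightarrow> x \<in># ends G e \<Longrightarrow> edge_colourable k (component_of G x)"
  shows "edge_colourable k G"
proof -
  \<comment> \<open>The choice depends on the component itself and not on a representative vertex,
    so equal components get equal colourings.\<close>
  define \<chi> where "\<chi> K = (SOME c. proper_edge_colouring k K c)" for K :: "('a, 'b) multipole"
  define c where "c e = \<chi> (component_of G (SOME x. x \<in># ends G e)) e" for e
  have same: "component_of G x = component_of G y"
    if e: "e \<in> edges G" and xy: "x \<in># ends G e" "y \<in># ends G e" for e x y
  proof -
    obtain a b where "ends G e = {#a, b#}" using mset_size_2[of "ends G e"] G[OF e] by blast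
    then have "x = y \<or> adjacent G x y"
      using e xy by (auto simp: adjacent_def add_mset_commute)
    then show ?thesis using component_of_eq by metis
  qed
  have c: "c e = \<chi> (component_of G x) e" if "e \<in> edges G" "x \<in># ends G e" for e x
    unfolding c_def using same[OF that(1) _ that(2)] someI[of "\<lambda>x. x \<in># ends G e", OF that(2)] by simp
  have proper: "proper_edge_colouring k (component_of G x) (\<chi> (component_of G x))"
    if "e \<in> edges G" "x \<in># ends G e" for e x
    using col[OF that] unfolding edge_colourable_def \<chi>_def by (rule someI_ex)
  have mem: "e \<in> edges (component_of G x)" if "e \<in> edges G" "x \<in># ends G e" for e x
  proof -
    have "y \<in> verts G \<and> (adjacent G)\<^sup>*\<^sup>* x y" if "y \<in># ends G e" for y
    proof -
      have "component_of G y = component_of G x" using same \<open>e \<in> edges G\<close> \<open>x \<in># ends G e\<close> that by blast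
      moreover have "y \<in> verts G" using G \<open>e \<in> edges G\<close> that by blast
      then have "y \<in> verts (component_of G y)" by (simp add: component_of_def Let_def)
      ultimately show ?thesis by (simp add: component_of_def Let_def)
    qed
    then show ?thesis using that(1) by (auto simp: component_of_def Let_def)
  qed
  have ends: "ends (component_of G x) = ends G" for x by (simp add: component_of_def Let_def)
  have nonempty: "\<exists>x. x \<in># ends G e" if "e \<in> edges G" for e
    using G[OF that] by (metis multiset_nonemptyE size_empty zero_neq_numeral)
  have "c e < k \<and> (\<forall>y. count (ends G e) y \<le> 1)" if e: "e \<in> edges G" for e
  proof -
    obtain x where x: "x \<in># ends G e" using nonempty e by blast
    show ?thesis using proper[OF e x] mem[OF e x] c[OF e x] ends
      by (simp add: proper_edge_colouring_def)
  qed
  moreover have "c e \<noteq> c f" if e: "e \<in> edges G" and f: "f \<in> edges G" and "e \<noteq> f"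
    and x: "x \<in># ends G e" "x \<in># ends G f" for e f x
  proof -
    have "set_mset (ends G e) \<inter> set_mset (ends G f) \<noteq> {}" using x by blast
    then show ?thesis
      using proper[OF e x(1)] mem[OF e x(1)] mem[OF f x(2)] \<open>e \<noteq> f\<close>
      unfolding c[OF e x(1)] c[OF f x(2)] proper_edge_colouring_def ends by blast
  qed
  ultimately have "proper_edge_colouring k G c"
    unfolding proper_edge_colouring_def by blast
  then show ?thesis by (auto simp: edge_colourable_def)
qed

subsection \<open>Completion to a cubic graph\<close>

text \<open>Edges are added between vertices of degree below 3 until none is left. \<open>E\<close>
  is a supply of edge names: as long as some degree is below 3, twice the number of edges is below
  \<open>3 * card (verts K)\<close>, so a name is free.\<close>

lemma cubic_completion:
  assumes "graph K" "\<And>x. x \<in> verts K \<Longrightarrow> degree K x \<le> 3" "even (card (verts K))"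
    and "finite E" "edges K \<subseteq> E" "3 * card (verts K) \<le> 2 * card E"
  shows "\<exists>H. completes H K \<and> verts H = verts K"
  using assms
proof (induction "card (E - edges K)" arbitrary: K rule: less_induct)
  case less
  note gr = less.prems(1) and le3 = less.prems(2)
  have fin: "finite (verts K)" "finite (edges K)" using gr by (auto simp: graph_def)
  have sum: "(\<Sum>x\<in>verts K. degree K x) = 2 * card (edges K)"
    using graph_sum_degree_in[OF gr] by (simp add: degree_eq_degree_in)
  show ?case
  proof (cases "\<forall>x\<in>verts K. degree K x = 3")
    case True
    then have "completes K K" using gr by (simp add: completes_def cubic_graph_def)
    then show ?thesis by blast
  next
    case False
    then obtain a where a: "a \<in> verts K" "degree K a < 3" using le3 by (metis le_neq_implies_less)
    \<comment> \<open>The new edge needs two free places: a second deficient vertex, or a loop at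
      \<open>a\<close> if its degree is at most 1. Otherwise \<open>a\<close> has degree 2 and all
      other vertices have degree 3, and the degree sum is odd because the order is even.\<close>
    have "\<exists>b\<in>verts K. degree K b < 3 \<and> (a = b \<longrightarrow> degree K a \<le> 1)"
    proof (rule ccontr)
      assume neg: "\<not> ?thesis"
      then have "\<not> degree K a \<le> 1" using a by blast
      then have "degree K a = 2" using a(2) by simp
      moreover have "\<forall>x\<in>verts K - {a}. degree K x = 3"
        using neg le3 by (metis DiffD1 DiffD2 insertI1 le_neq_implies_less)
      ultimately have "2 * card (edges K) = 2 + 3 * (card (verts K) - 1)"
        using sum sum.remove[OF fin(1) a(1), of "degree K"] fin(1) a(1) by simp
      moreover have "card (verts K) > 0" using a(1) fin(1) by (auto simp: card_gt_0_iff)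
      ultimately show False using less.prems(3) by presburger
    qed
    then obtain b where b: "b \<in> verts K" "degree K b < 3" "a = b \<Longrightarrow> degree K a \<le> 1" by blast
    have "(\<Sum>x\<in>verts K. degree K x) < (\<Sum>x\<in>verts K. 3)"
      by (rule sum_strict_mono_ex1) (use fin le3 a in auto)
    then have "card (edges K) < card E" using sum less.prems(6) by simp
    then obtain e where e: "e \<in> E" "e \<notin> edges K"
      by (metis fin(2) card_mono not_less subsetI)
    define K' where "K' = \<lparr>verts = verts K, edges = insert e (edges K), ends = (ends K)(e := {#a, b#})\<rparr>"
    have K': "verts K' = verts K" "edges K' = insert e (edges K)" by (simp_all add: K'_def)
    have deg: "degree K' x = count {#a, b#} x + degree K x" for x
    proof -
      have "(\<Sum>f\<in>edges K. count (ends K' f) x) = (\<Sum>f\<in>edges K. count (ends K f) x)"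
        by (rule sum.cong) (use e(2) in \<open>auto simp: K'_def\<close>)
      then show ?thesis using e(2) fin(2) by (simp add: degree_def K'_def)
    qed
    have "\<exists>H. completes H K' \<and> verts H = verts K'"
    proof (rule less.hyps)
      show "card (E - edges K') < card (E - edges K)"
        using e less.prems(4) K' by (intro psubset_card_mono) auto
      show "graph K'" using gr a(1) b(1) by (auto simp: graph_def K'_def)
      show "degree K' x \<le> 3" if "x \<in> verts K'" for x
        using le3[of x] a b that by (auto simp: deg K')
    qed (use less.prems e K' in auto)
    moreover have "completes H K" if "completes H K'" for H
      using that e(2) by (auto simp: completes_def K'_def split: if_splits)
    ultimately show ?thesis using K' by auto
  qed
qed

text \<open>If the order of \<open>K\<close> is odd, \<open>u\<close> is added as a vertex of degree
  0. As \<open>v\<close> stays outside, the order remains below that of \<open>G\<close>, and the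
  edges of \<open>G\<close> supply enough names.\<close>

lemma cubic_completion_subgraph:
  assumes G: "cubic_graph G"
    and K: "graph K" "edges K \<subseteq> edges G" "\<And>e. e \<in> edges K \<Longrightarrow> ends K e = ends G e"
    and uv: "verts K \<subseteq> verts G - {u, v}" "u \<in> verts G" "v \<in> verts G" "u \<noteq> v"
  shows "\<exists>H. completes H K \<and> card (verts H) < card (verts G)"
proof -
  have fin: "finite (verts G)" "finite (edges G)" using G by (auto simp: cubic_graph_def graph_def)
  define V where "V = (if even (card (verts K)) then verts K else insert u (verts K))"
  define K' where "K' = K\<lparr>verts := V\<rparr>"
  have finK: "finite (verts K)" and uK: "u \<notin> verts K" using K(1) uv(1) by (auto simp: graph_def)
  have "V \<subset> verts G" unfolding V_def using uv by auto
  then have card: "card V < card (verts G)" using fin(1) by (rule psubset_card_mono[rotated])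
  have sub: "V \<subseteq> verts G" using \<open>V \<subset> verts G\<close> by auto
  have "\<exists>H. completes H K' \<and> verts H = verts K'"
  proof (rule cubic_completion)
    show "graph K'" using K(1) by (auto simp: graph_def K'_def V_def)
    show "even (card (verts K'))" using finK uK by (simp add: K'_def V_def)
    show "edges K' \<subseteq> edges G" using K(2) by (simp add: K'_def)
    show "3 * card (verts K') \<le> 2 * card (edges G)"
      using cubic_graph_card[OF G] card by (simp add: K'_def)
    fix x assume "x \<in> verts K'"
    then have "degree G x = 3" using sub G by (auto simp: K'_def cubic_graph_def)
    moreover have "degree K' x = degree_in G (edges K) x"
      unfolding degree_def degree_in_def by (rule sum.cong) (auto simp: K'_def K(3))
    ultimately show "degree K' x \<le> 3"
      using degree_in_mono[OF fin(2) K(2), of G x] by (simp add: degree_eq_degree_in)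
  qed (rule fin(2))
  then obtain H where "completes H K'" "verts H = V" by (auto simp: K'_def)
  moreover from this have "completes H K"
    by (auto simp: completes_def K'_def V_def split: if_splits)
  ultimately show ?thesis using card by blast
qed

subsection \<open>Irreducibility\<close>

text \<open>With a loop no number of colours suffices, and the infimum of the empty set is
  \<open>\<infinity>\<close>; therefore four colours have to suffice only in the loopless
  case.\<close>

lemma chromatic_index_4_or_infinity:
  assumes "\<not> edge_colourable 3 K"
    and "(\<And>e x. e \<in> edges K \<Longrightarrow> count (ends K e) x \<le> 1) \<Longrightarrow> edge_colourable 4 K"
  shows "chromatic_index K \<in> {4, \<infinity>}"
proof (cases "\<forall>e\<in>edges K. \<forall>x. count (ends K e) x \<le> 1")
  case True
  then have four: "edge_colourable 4 K" using assms(2) by blast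
  have "4 \<le> k" if "edge_colourable k K" for k
  proof (rule ccontr)
    assume "\<not> 4 \<le> k"
    then have "edge_colourable 3 K" by (intro edge_colourable_mono[OF that]) auto
    with assms(1) show False ..
  qed
  then have "chromatic_index K = enat 4"
    unfolding chromatic_index_def using four
    by (intro antisym Inf_lower Inf_greatest) auto
  then show ?thesis by (simp add: numeral_eq_enat)
next
  case False
  then have "{k. edge_colourable k K} = {}"
    by (auto simp: edge_colourable_def proper_edge_colouring_def)
  then show ?thesis by (simp add: chromatic_index_def Inf_enat_def)
qed

lemma chromatic_index_imp_not_3_colourable:
  assumes "chromatic_index K \<in> {4, \<infinity>}"
  shows "\<not> edge_colourable 3 K"
proof
  assume "edge_colourable 3 K"
  then have "chromatic_index K \<le> enat 3"
    unfolding chromatic_index_def by (intro Inf_lower) auto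
  with assms show False by (auto simp: numeral_eq_enat)
qed

lemma bicritical_imp_irreducible:
  assumes G: "cubic_graph G" and bi: "bicritical G"
  shows "irreducible G"
proof -
  have False if K: "K \<in> components (remove_edges G S)" and ci: "chromatic_index K \<in> {4, \<infinity>}"
    and H: "completes H K" "card (verts H) < card (verts G)" for S K H
  proof -
    have KG: "verts K \<subseteq> verts G" "edges K \<subseteq> edges G" "ends K = ends G"
      and Kends: "\<And>e. e \<in> edges K \<Longrightarrow> set_mset (ends G e) \<subseteq> verts K"
      using K by (auto simp: components_def component_of_def remove_edges_def Let_def)
    have fin: "finite (verts G)" "finite (verts H)" "cubic_graph H" "verts K \<subseteq> verts H"
      using G H(1) by (auto simp: completes_def cubic_graph_def graph_def)
    \<comment> \<open>If \<open>K\<close> missed two vertices, its edges would keep all their ends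
      when these are removed, and the 3-edge-colouring given by bicriticality would restrict to
      \<open>K\<close>.\<close>
    have "u = v" if uv: "u \<in> verts G - verts K" "v \<in> verts G - verts K" for u v
    proof (rule ccontr)
      assume "u \<noteq> v"
      with bi uv have "edge_colourable 3 (remove_verts G {u, v})" by (auto simp: bicritical_def)
      then have "edge_colourable 3 K"
      proof (rule edge_colourable_mono)
        fix e assume "e \<in> edges K"
        then have "\<forall>x. x \<in># ends G e \<longrightarrow> x \<noteq> u \<and> x \<noteq> v" using Kends uv by blast
        then show "ends K e = ends (remove_verts G {u, v}) e"
          by (simp add: KG remove_verts_def eq_commute[of "ends G e"] filter_mset_eq_conv)
      qed (simp_all add: remove_verts_def KG)
      with chromatic_index_imp_not_3_colourable[OF ci] show False ..
    qed
    then have "card (verts G - verts K) \<le> 1"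
      by (metis One_nat_def card_le_Suc0_iff_eq fin(1) finite_Diff)
    moreover have "card (verts G - verts K) = card (verts G) - card (verts K)"
      using KG(1) fin(1) by (meson card_Diff_subset finite_subset)
    moreover have "card (verts K) \<le> card (verts H)" using fin by (intro card_mono)
    \<comment> \<open>\<open>H\<close> contains \<open>K\<close>, which misses at most one vertex of
      \<open>G\<close>; so the orders of \<open>G\<close> and \<open>H\<close> differ by exactly
      one, although both are even.\<close>
    ultimately have "card (verts G) = Suc (card (verts H))" using H(2) by linarith
    then show False
      using cubic_graph_even_card[OF G] cubic_graph_even_card[OF fin(3)] by simp
  qed
  then show ?thesis unfolding irreducible_def k_irreducible_def by blast
qed

lemma k_irreducible_7_imp_bicritical:
  assumes "snark G" and irr: "k_irreducible 7 G"
  shows "bicritical G"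
  unfolding bicritical_def
proof (intro ballI impI, rule ccontr)
  fix u v assume uv: "u \<in> verts G" "v \<in> verts G" "u \<noteq> v"
    and not_col: "\<not> edge_colourable 3 (remove_verts G {u, v})"
  have G: "cubic_graph G" "connected G" using assms(1) by (auto simp: snark_def)
  then have gr: "graph G" and fin: "finite (edges G)" by (auto simp: cubic_graph_def graph_def)
  define S where "S = {e \<in> edges G. \<exists>x\<in>{u, v}. x \<in># ends G e}"
  let ?R = "remove_edges G S"
  have R: "edges ?R = edges G - S" "ends ?R = ends G" "verts ?R = verts G"
    by (simp_all add: remove_edges_def)
  have "\<not> edge_colourable 3 ?R"
    using edge_colourable_remove_verts[OF G(1), of "{u, v}"] not_col unfolding S_def by blast
  \<comment> \<open>The edge \<open>f\<close> survives the removal of \<open>S\<close>, so its end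
    \<open>x\<close> is neither \<open>u\<close> nor \<open>v\<close>.\<close>
  then obtain f x where f: "f \<in> edges ?R" "x \<in># ends G f"
    and nc: "\<not> edge_colourable 3 (component_of ?R x)"
    using edge_colourable_components[of ?R 3] gr R by (fastforce simp: graph_def)
  define K where "K = component_of ?R x"
  have x: "x \<in> verts G" "x \<noteq> u" "x \<noteq> v" using f gr R by (auto simp: S_def graph_def)
  have KR: "edges K \<subseteq> edges G - S" "ends K = ends G" "verts K \<subseteq> verts G"
    "\<And>e. e \<in> edges K \<Longrightarrow> set_mset (ends G e) \<subseteq> verts K"
    by (auto simp: K_def component_of_def Let_def R)
  \<comment> \<open>Without \<open>S\<close> the vertices \<open>u\<close> and \<open>v\<close> are
    isolated, so the component of \<open>x\<close> misses both; this leaves room for a smaller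
    completion.\<close>
  have "y \<noteq> u \<and> y \<noteq> v" if "(adjacent ?R)\<^sup>*\<^sup>* x y" for y
    using that
  proof (induction rule: rtranclp_induct)
    case (step y z)
    then obtain e where "e \<in> edges G - S" "ends G e = {#y, z#}" by (auto simp: adjacent_def R)
    then show ?case by (auto simp: S_def)
  qed (use x in simp)
  then have Kuv: "verts K \<subseteq> verts G - {u, v}"
    by (auto simp: K_def component_of_def Let_def R)
  have grK: "graph K"
    using gr KR(1,2,4) finite_subset[OF KR(3)] finite_subset[OF KR(1)] by (auto simp: graph_def)
  \<comment> \<open>Here the constant 7 arises: \<open>u\<close> and \<open>v\<close> have six edge
    ends in all. Loops at them and edges joining them are counted twice, so six is only an upper
    bound.\<close>
  have "card S < 7"
  proof -
    have "card S = (\<Sum>e\<in>S. 1)" by simp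
    also have "\<dots> \<le> (\<Sum>e\<in>S. count (ends G e) u + count (ends G e) v)"
      by (rule sum_mono) (auto simp: S_def Suc_le_eq simp flip: count_greater_zero_iff)
    also have "\<dots> \<le> (\<Sum>e\<in>edges G. count (ends G e) u + count (ends G e) v)"
      by (rule sum_mono2) (use fin in \<open>auto simp: S_def\<close>)
    also have "\<dots> = degree G u + degree G v" by (simp add: degree_def sum.distrib)
    also have "\<dots> = 6" using G(1) uv by (simp add: cubic_graph_def)
    finally show ?thesis by simp
  qed
  moreover have "S \<subseteq> edges G" by (auto simp: S_def)
  moreover have "K \<in> components ?R" using x by (simp add: K_def components_def R)
  moreover have "chromatic_index K \<in> {4, \<infinity>}"
  proof (rule chromatic_index_4_or_infinity)
    show "\<not> edge_colourable 3 K" using nc by (simp add: K_def)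
    assume "\<And>e y. e \<in> edges K \<Longrightarrow> count (ends K e) y \<le> 1"
    \<comment> \<open>No edge of \<open>K\<close> meets \<open>u\<close>, so the greedy argument for
      edge sets avoiding a vertex applies.\<close>
    then have "edge_colourable 4 (G\<lparr>edges := edges K\<rparr>)"
      using KR Kuv uv by (intro four_edge_colourable_avoiding_vertex[OF G, of _ u]) fastforce+
    then show "edge_colourable 4 K" by (rule edge_colourable_mono) (simp_all add: KR)
  qed
  moreover obtain H where "completes H K" "card (verts H) < card (verts G)"
    using cubic_completion_subgraph[OF G(1) grK _ _ Kuv uv] KR by auto
  ultimately show False using irr unfolding k_irreducible_def by blast
qed

theorem theorem5:
  fixes G :: "('v, 'e) multipole"
  assumes "snark G"
  shows "(bicritical G \<longleftrightarrow> four_vertex_critical G) \<and>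
         (four_vertex_critical G \<longleftrightarrow> k_irreducible 7 G) \<and>
         (k_irreducible 7 G \<longleftrightarrow> irreducible G)"
proof -
  have "cubic_graph G" using assms by (simp add: snark_def)
  moreover have "irreducible G \<Longrightarrow> k_irreducible 7 G" by (simp add: irreducible_def)
  ultimately show ?thesis
    using bicritical_iff_four_vertex_critical bicritical_imp_irreducible
      k_irreducible_7_imp_bicritical[OF assms] by blast
qed

end
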